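(* Let $P$ be a finite poset on a set of goods, representing the preferences of an agent ($a<b$ in $P$ meaning that the agent prefers a unit of good $b$ to a unit of good $a$). The advantageous trades of the agent are precisely the trades which can be reached by a finite number of trades of pairs of goods in which the agent trades a good for one which they prefer. That is, a vector $\mathbf{v}\in\mathbb{R}^P$ is an advantageous trade if and only if it is a finite sum $\mathbf{v}=\sum_k c_k(e_{y_k}-e_{x_k})$ with $c_k\in\mathbb{R}_{\ge0}$ and $x_k<y_k$ in $P$.
   Context: $(e_p)_{p\in P}$ is the standard basis of $\mathbb{R}^P$. Goods are denominated in units trading at ratio 1:1, a vector $\mathbf{v}\in\mathbb{R}^P$ records net amounts of each good, and a trade is a vector $\mathbf{v}$ with $\sum_{p\in P}v_p=0$. A trade $\mathbf{v}$ is advantageous if the representation $M_P$ is $\mathbf{v}$-semistable; equivalently, if $\sum_{p\in P}v_p=0$ and $\sum_{l\in L}v_l\le 0$ for every lower set $L\subseteq P$ (equivalently $\sum_{u\in U}v_u\ge0$ for every upper set $U$). Here $M_P$ is the representation, over a field $K$, of the Hasse quiver of $P$ (vertices $P$, an arrow $y\to x$ for each covering relation $x\lessdot y$) with $K$ at each vertex and identity maps; a lower set is a subset $L$ such that $x\le y\in L$ implies $x\in L$. A non-zero representation $M$ is $\mathbf{v}$-semistable if $\langle\mathbf{v},\underline{\dim}M\rangle=0$ and $\langle\mathbf{v},\underline{\dim}L\rangle\le0$ for every proper subrepresentation $L$. *)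

theory Defs
  imports "HOL-Analysis.Analysis" "Graph_Theory.Digraph"
begin

section \<open>Finite-dimensional representations of finite quivers\<close>

text \<open>
  A quiver is a directed multigraph. The vector spaces \<open>V i\<close> at the vertices are subspaces of one
  ambient vector space; up to isomorphism this loses nothing, since the ambient space can be taken
  to be the direct sum. Finite-dimensionality of \<open>V i\<close> is assumed because \<open>dim\<close> is \<open>0\<close> otherwise.
\<close>

locale quiver_rep = fin_digraph Q + vector_space scale
  for Q :: "('q, 'a) pre_digraph"
    and scale :: "'k::field \<Rightarrow> 'v::ab_group_add \<Rightarrow> 'v" (infixr "*s" 75) +
  fixes V :: "'q \<Rightarrow> 'v set"
    and f :: "'a \<Rightarrow> 'v \<Rightarrow> 'v"
  assumes subspace_V: "i \<in> verts Q \<Longrightarrow> subspace (V i)"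
    and fin_dim_V: "i \<in> verts Q \<Longrightarrow> \<exists>B. finite B \<and> V i = span B"
    and map_V: "a \<in> arcs Q \<Longrightarrow> x \<in> V (tail Q a) \<Longrightarrow> f a x \<in> V (head Q a)"
    and map_add: "a \<in> arcs Q \<Longrightarrow> x \<in> V (tail Q a) \<Longrightarrow> y \<in> V (tail Q a) \<Longrightarrow>
          f a (x + y) = f a x + f a y"
    and map_scale: "a \<in> arcs Q \<Longrightarrow> x \<in> V (tail Q a) \<Longrightarrow> f a (c *s x) = c *s f a x"
begin

definition nonzero :: bool
  where "nonzero \<longleftrightarrow> (\<exists>i\<in>verts Q. V i \<noteq> {0})"

definition subrep :: "('q \<Rightarrow> 'v set) \<Rightarrow> bool"
  where "subrep W \<longleftrightarrow>
    (\<forall>i\<in>verts Q. subspace (W i) \<and> W i \<subseteq> V i) \<and>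
    (\<forall>a\<in>arcs Q. f a ` W (tail Q a) \<subseteq> W (head Q a))"

definition proper_subrep :: "('q \<Rightarrow> 'v set) \<Rightarrow> bool"
  where "proper_subrep W \<longleftrightarrow> subrep W \<and> (\<exists>i\<in>verts Q. W i \<noteq> V i)"

text \<open>The pairing \<open>\<langle>\<theta>, dim W\<rangle>\<close> of a weight with a dimension vector.\<close>

definition pairing :: "('q \<Rightarrow> real) \<Rightarrow> ('q \<Rightarrow> 'v set) \<Rightarrow> real"
  where "pairing \<theta> W = (\<Sum>i\<in>verts Q. \<theta> i * real (dim (W i)))"

definition semistable :: "('q \<Rightarrow> real) \<Rightarrow> bool"
  where "semistable \<theta> \<longleftrightarrow> nonzero \<and> pairing \<theta> V = 0 \<and>
    (\<forall>W. proper_subrep W \<longrightarrow> pairing \<theta> W \<le> 0)"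

end


section \<open>The Hasse quiver of a finite poset and advantageous trades\<close>

definition covered_by :: "'p::order \<Rightarrow> 'p \<Rightarrow> bool"
  where "covered_by x y \<longleftrightarrow> x < y \<and> \<not> (\<exists>z. x < z \<and> z < y)"

text \<open>The arrow \<open>y \<rightarrow> x\<close> for a covering relation \<open>x \<lessdot> y\<close> is encoded as the pair \<open>(y, x)\<close>.\<close>

definition hasse_quiver :: "('p::{finite,order}, 'p \<times> 'p) pre_digraph"
  where "hasse_quiver =
    \<lparr>verts = UNIV, arcs = {(y, x). covered_by x y}, tail = fst, head = snd\<rparr>"

text \<open>\<open>M\<^sub>P\<close>: the one-dimensional space \<open>K\<close> at each vertex, and identity maps.\<close>

definition M_space :: "'p::{finite,order} \<Rightarrow> 'k::field set"
  where "M_space p = UNIV"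

definition M_map :: "'p::{finite,order} \<times> 'p \<Rightarrow> 'k::field \<Rightarrow> 'k"
  where "M_map a = id"

lemma quiver_rep_M:
  "quiver_rep hasse_quiver ((*) :: 'k::field \<Rightarrow> 'k \<Rightarrow> 'k)
     (M_space :: 'p::{finite,order} \<Rightarrow> 'k set) M_map"
proof -
  have fin: "fin_digraph (hasse_quiver :: ('p, 'p \<times> 'p) pre_digraph)"
    by unfold_locales (auto simp: hasse_quiver_def)
  have "\<exists>B. finite B \<and> (UNIV :: 'k set) = vector_space_over_itself.span B"
    by (rule exI[of _ "{1}"]) (auto simp: vector_space_over_itself.span_singleton)
  then show ?thesis
    by (intro quiver_rep.intro fin vector_space_over_itself.vector_space_axioms
        quiver_rep_axioms.intro)
      (auto simp: M_space_def M_map_def vector_space_over_itself.subspace_UNIV)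
qed

definition trade :: "real ^ 'p \<Rightarrow> bool"
  where "trade v \<longleftrightarrow> (\<Sum>p\<in>UNIV. v $ p) = 0"

definition advantageous :: "'k::field itself \<Rightarrow> real ^ 'p::{finite,order} \<Rightarrow> bool"
  where "advantageous K v \<longleftrightarrow> trade v \<and>
    quiver_rep.semistable hasse_quiver ((*) :: 'k \<Rightarrow> 'k \<Rightarrow> 'k) M_space M_map (($) v)"

end

theory Submission
  imports Defs
begin

text \<open>
  For the representation \<open>M\<^sub>P\<close>, semistability is a finite system of linear inequalities. Each vertex
  carries the line \<open>K\<close>, whose only subspaces are \<open>0\<close> and \<open>K\<close>, so a subrepresentation is determined
  by its support. As the arrows are identity maps pointing down along covering relations, the
  supports are exactly the sets closed under passing to a covered element, and in a finite poset
  those are the lower sets. Hence \<open>v\<close> is advantageous iff its entries sum to \<open>0\<close> and their sum over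
  every lower set is at most \<open>0\<close> (\<open>advantageous_iff_lower_sums\<close>).

  An elementary trade \<open>e\<^sub>y - e\<^sub>x\<close> with \<open>x < y\<close> satisfies these inequalities, since a lower set
  containing \<open>y\<close> contains \<open>x\<close>; so do nonnegative combinations of such trades. The converse is linear
  programming duality. The elementary trades generate a closed convex cone, so a vector \<open>v\<close> outside
  it is separated from it by a linear functional \<open>a\<close> that is nonnegative on the generators and
  negative on \<open>v\<close> (\<open>in_convex_cone_hull_finite_if_dual_nonneg\<close>). Nonnegativity on the generators
  says precisely that \<open>p \<mapsto> a\<^sub>p\<close> is monotone on \<open>P\<close>. A monotone function is a constant minus a
  nonnegative combination of indicators of lower sets, so the inequalities for \<open>v\<close> force it to be
  nonnegative on \<open>v\<close> (\<open>monotone_pairing_nonneg\<close>), a contradiction.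
\<close>

section \<open>Lower sets of a finite poset\<close>

definition lower_set :: "'p::order set \<Rightarrow> bool"
  where "lower_set L \<longleftrightarrow> (\<forall>x y. x \<le> y \<longrightarrow> y \<in> L \<longrightarrow> x \<in> L)"

text \<open>
  In a finite poset every relation \<open>x < y\<close> is refined to a chain of covering relations, so closure
  along the arrows of the Hasse quiver is closure along the order.
\<close>

lemma lower_set_iff_closed_under_covers:
  fixes L :: "'p::{finite,order} set"
  shows "lower_set L \<longleftrightarrow> (\<forall>x y. covered_by x y \<longrightarrow> y \<in> L \<longrightarrow> x \<in> L)"
proof
  assume "lower_set L"
  then show "\<forall>x y. covered_by x y \<longrightarrow> y \<in> L \<longrightarrow> x \<in> L"
    by (auto simp: lower_set_def covered_by_def dest: less_imp_le)
next
  assume closed: "\<forall>x y. covered_by x y \<longrightarrow> y \<in> L \<longrightarrow> x \<in> L"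
  have "x \<in> L" if "x \<le> y" "y \<in> L" for x y
    using that
  proof (induction "card {x..<y}" arbitrary: x y rule: less_induct)
    case less
    consider "x = y" | "covered_by x y" | z where "x < z" "z < y"
      using less.prems(1) by (auto simp: covered_by_def le_less)
    then show ?case
    proof cases
      case 1
      then show ?thesis using less.prems by simp
    next
      case 2
      then show ?thesis using closed less.prems by blast
    next
      case (3 z)
      have "{z..<y} \<subseteq> {x..<y}" "x \<in> {x..<y} - {z..<y}"
        "{x..<z} \<subseteq> {x..<y}" "z \<in> {x..<y} - {x..<z}"
        using 3 by auto
      then have "{z..<y} \<subset> {x..<y}" "{x..<z} \<subset> {x..<y}"
        by blast+
      then have "card {z..<y} < card {x..<y}" "card {x..<z} < card {x..<y}"
        by (simp_all add: psubset_card_mono)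
      then show ?thesis
        using less.hyps[of z y] less.hyps[of x z] less.prems 3 by (simp add: less_imp_le)
    qed
  qed
  then show "lower_set L"
    unfolding lower_set_def by blast
qed


section \<open>Semistability of the representation of a poset\<close>

lemma subspace_field_iff:
  fixes W :: "'k::field set"
  shows "vector_space_over_itself.subspace W \<longleftrightarrow> W = {0} \<or> W = UNIV"
proof
  assume W: "vector_space_over_itself.subspace W"
  have "W = UNIV" if "w \<in> W" "w \<noteq> 0" for w
  proof -
    have "c \<in> W" for c
      using vector_space_over_itself.subspace_scale[OF W that(1), of "c / w"] that(2) by simp
    then show ?thesis by blast
  qed
  moreover have "0 \<in> W"
    using W by (rule vector_space_over_itself.subspace_0)
  ultimately show "W = {0} \<or> W = UNIV" by blast
qed (auto simp: vector_space_over_itself.subspace_UNIV vector_space_over_itself.subspace_single_0)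

lemma dim_field_subspace:
  fixes W :: "'k::field set"
  assumes "vector_space_over_itself.subspace W"
  shows "real (vector_space_over_itself.dim W) = (if W = {0} then 0 else 1)"
proof -
  have "vector_space_over_itself.dim (UNIV :: 'k set) = 1"
    by simp
  moreover have "vector_space_over_itself.dim ({0} :: 'k set) = 0"
    by simp
  ultimately show ?thesis
    using assms by (auto simp: subspace_field_iff)
qed

text \<open>
  The dimension vector of a subrepresentation is the indicator of its support, so the pairing with
  a subrepresentation is the sum over a lower set. A lower set different from \<open>P\<close> supports a proper
  subrepresentation, and for \<open>P\<close> itself the sum is \<open>0\<close> because \<open>v\<close> is a trade.
\<close>

lemma advantageous_iff_lower_sums:
  fixes v :: "real ^ 'p::{finite,order}"
  shows "advantageous TYPE('k::field) v \<longleftrightarrow>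
    trade v \<and> (\<forall>L. lower_set L \<longrightarrow> (\<Sum>l\<in>L. v $ l) \<le> 0)"
proof -
  interpret M: quiver_rep hasse_quiver "(*) :: 'k \<Rightarrow> 'k \<Rightarrow> 'k"
    "M_space :: 'p \<Rightarrow> 'k set" M_map
    by (rule quiver_rep_M)
  have pairing: "M.pairing (($) v) W = (\<Sum>i | W i \<noteq> {0}. v $ i)"
    if "\<And>i. vector_space_over_itself.subspace (W i)" for W :: "'p \<Rightarrow> 'k set"
  proof -
    have "M.pairing (($) v) W = (\<Sum>i\<in>UNIV. if W i \<noteq> {0} then v $ i else 0)"
      unfolding M.pairing_def by (intro sum.cong) (auto simp: hasse_quiver_def dim_field_subspace that)
    then show ?thesis by (simp add: sum.If_cases)
  qed
  have UNIV_neq: "(UNIV :: 'k set) \<noteq> {0}"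
    by (metis UNIV_I singletonD zero_neq_one)
  have pairing_M: "M.pairing (($) v) M_space = (\<Sum>p\<in>UNIV. v $ p)"
    by (subst pairing) (auto simp: M_space_def vector_space_over_itself.subspace_UNIV UNIV_neq)
  have nonzero: M.nonzero
    unfolding M.nonzero_def using UNIV_neq by (simp add: hasse_quiver_def M_space_def)
  have subrep: "M.subrep W \<longleftrightarrow> (\<forall>i. vector_space_over_itself.subspace (W i)) \<and>
      (\<forall>x y. covered_by x y \<longrightarrow> W y \<subseteq> W x)" for W
    unfolding M.subrep_def by (auto simp: hasse_quiver_def M_space_def M_map_def)
  have support: "lower_set {i. W i \<noteq> {0}}" if "M.subrep W" for W
    unfolding lower_set_iff_closed_under_covers
  proof (intro allI impI CollectI)
    fix x y :: 'p
    assume "covered_by x y" and y: "y \<in> {i. W i \<noteq> {0}}"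
    then have "W y \<subseteq> W x" and sub: "vector_space_over_itself.subspace (W y)"
      using that by (auto simp: subrep)
    moreover have "W y = UNIV"
      using sub y by (simp add: subspace_field_iff)
    ultimately show "W x \<noteq> {0}"
      using UNIV_neq by auto
  qed
  show ?thesis
  proof
    assume adv: "advantageous TYPE('k) v"
    then have tr: "trade v" and ss: "M.semistable (($) v)"
      by (auto simp: advantageous_def)
    have "(\<Sum>l\<in>L. v $ l) \<le> 0" if L: "lower_set L" for L
    proof (cases "L = UNIV")
      case True
      then show ?thesis using tr by (simp add: trade_def)
    next
      case False
      define W where "W i = (if i \<in> L then UNIV else {0 :: 'k})" for i
      have sub: "vector_space_over_itself.subspace (W i)" for i
        by (simp add: W_def subspace_field_iff)
      have "M.subrep W"
        using L sub by (auto simp: subrep W_def lower_set_iff_closed_under_covers)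
      moreover obtain i where "i \<notin> L"
        using False by blast
      ultimately have "M.proper_subrep W"
        unfolding M.proper_subrep_def
        using UNIV_neq by (auto simp: hasse_quiver_def M_space_def W_def intro!: exI[of _ i])
      then have "M.pairing (($) v) W \<le> 0"
        using ss by (simp add: M.semistable_def)
      moreover have "{i. W i \<noteq> {0}} = L"
        using UNIV_neq by (auto simp: W_def)
      ultimately show ?thesis
        using pairing[of W] sub by simp
    qed
    then show "trade v \<and> (\<forall>L. lower_set L \<longrightarrow> (\<Sum>l\<in>L. v $ l) \<le> 0)"
      using tr by blast
  next
    assume R: "trade v \<and> (\<forall>L. lower_set L \<longrightarrow> (\<Sum>l\<in>L. v $ l) \<le> 0)"
    have "M.pairing (($) v) W \<le> 0" if "M.proper_subrep W" for W
    proof -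
      have W: "M.subrep W"
        using that by (simp add: M.proper_subrep_def)
      then show ?thesis
        using R support[OF W] by (simp add: pairing subrep)
    qed
    then show "advantageous TYPE('k) v"
      using R nonzero pairing_M by (simp add: advantageous_def M.semistable_def trade_def)
  qed
qed


section \<open>Finitely generated cones and duality\<close>

lemma convex_cone_hull_image_finite:
  fixes g :: "'i \<Rightarrow> 'a::real_vector"
  assumes "finite I" and v: "v \<in> convex_cone hull (g ` I)"
  obtains c where "\<And>i. i \<in> I \<Longrightarrow> 0 \<le> c i" "v = (\<Sum>i\<in>I. c i *\<^sub>R g i)"
proof -
  let ?T = "{\<Sum>i\<in>I. c i *\<^sub>R g i | c. \<forall>i\<in>I. 0 \<le> (c i :: real)}"
  have "convex_cone hull (g ` I) \<subseteq> ?T"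
  proof (rule hull_minimal)
    show "g ` I \<subseteq> ?T"
    proof
      fix s assume "s \<in> g ` I"
      then obtain j where "j \<in> I" "s = g j" by blast
      then have "s = (\<Sum>i\<in>I. (if i = j then 1 else 0) *\<^sub>R g i)"
        using \<open>finite I\<close> by (simp add: if_distrib[of "\<lambda>r. r *\<^sub>R _"] cong: if_cong)
      then show "s \<in> ?T"
        by (intro CollectI exI[of _ "\<lambda>i. if i = j then 1 else 0"]) simp
    qed
    have "0 \<in> ?T"
      by (intro CollectI exI[of _ "\<lambda>_. 0"]) simp
    moreover have "x + y \<in> ?T" if "x \<in> ?T" "y \<in> ?T" for x y
    proof -
      obtain c where "\<forall>i\<in>I. 0 \<le> c i" "x = (\<Sum>i\<in>I. c i *\<^sub>R g i)"
        using \<open>x \<in> ?T\<close> by blast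
      moreover obtain d where "\<forall>i\<in>I. 0 \<le> d i" "y = (\<Sum>i\<in>I. d i *\<^sub>R g i)"
        using \<open>y \<in> ?T\<close> by blast
      ultimately show ?thesis
        by (intro CollectI exI[of _ "\<lambda>i. c i + d i"]) (simp add: scaleR_add_left sum.distrib)
    qed
    moreover have "r *\<^sub>R x \<in> ?T" if "x \<in> ?T" "0 \<le> r" for x r
    proof -
      obtain c where "\<forall>i\<in>I. 0 \<le> c i" "x = (\<Sum>i\<in>I. c i *\<^sub>R g i)"
        using \<open>x \<in> ?T\<close> by blast
      then show ?thesis
        using \<open>0 \<le> r\<close> by (intro CollectI exI[of _ "\<lambda>i. r * c i"]) (simp add: scaleR_sum_right)
    qed
    ultimately show "convex_cone ?T"
      unfolding convex_cone_iff by blast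
  qed
  then show thesis
    using v that by blast
qed

text \<open>
  Farkas' lemma. The hyperplane separating \<open>v\<close> from the closed cone can be moved to pass through
  the origin, because a linear functional bounded below on a cone is nonnegative there.
\<close>

lemma in_convex_cone_hull_finite_if_dual_nonneg:
  fixes S :: "'a::euclidean_space set"
  assumes "finite S"
    and dual: "\<And>a. (\<And>s. s \<in> S \<Longrightarrow> 0 \<le> a \<bullet> s) \<Longrightarrow> 0 \<le> a \<bullet> v"
  shows "v \<in> convex_cone hull S"
proof (rule ccontr)
  assume "v \<notin> convex_cone hull S"
  then obtain a b where av: "a \<bullet> v < b" and ax: "\<And>x. x \<in> convex_cone hull S \<Longrightarrow> b < a \<bullet> x"
    using separating_hyperplane_closed_point[OF convex_convex_cone_hull
        closed_convex_cone_hull[OF \<open>finite S\<close>]] by blast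
  have "b < 0"
    using ax[OF convex_cone_hull_contains_0] by simp
  have "0 \<le> a \<bullet> s" if "s \<in> S" for s
  proof (rule ccontr)
    assume neg: "\<not> 0 \<le> a \<bullet> s"
    \<comment> \<open>The multiple of \<open>s\<close> on which \<open>a\<close> takes the value \<open>b\<close> still lies in the cone.\<close>
    have "(b / (a \<bullet> s)) *\<^sub>R s \<in> convex_cone hull S"
      using that neg \<open>b < 0\<close>
      by (intro convex_cone_hull_mul hull_inc) (simp_all add: divide_nonpos_neg)
    from ax[OF this] show False
      using neg by simp
  qed
  then have "0 \<le> a \<bullet> v"
    by (rule dual)
  then show False
    using av \<open>b < 0\<close> by simp
qed


section \<open>Monotone functionals\<close>

text \<open>
  Summation by parts over the values of \<open>\<theta>\<close>: raising the smallest value \<open>m\<close> to the next one \<open>m'\<close>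
  keeps \<open>\<theta>\<close> monotone and changes the pairing by \<open>m' - m\<close> times the sum of \<open>w\<close> over the lower set
  \<open>{p. \<theta> p = m}\<close>, hence never increases it. Once \<open>\<theta>\<close> is constant, the pairing is a multiple of the
  total sum \<open>0\<close>.
\<close>

lemma monotone_pairing_nonneg:
  fixes w \<theta> :: "'p::{finite,order} \<Rightarrow> real"
  assumes total: "(\<Sum>p\<in>UNIV. w p) = 0"
    and lower: "\<And>L. lower_set L \<Longrightarrow> (\<Sum>l\<in>L. w l) \<le> 0"
    and "mono \<theta>"
  shows "0 \<le> (\<Sum>p\<in>UNIV. \<theta> p * w p)"
  using \<open>mono \<theta>\<close>
proof (induction "card (range \<theta>)" arbitrary: \<theta> rule: less_induct)
  case less
  define m where "m = Min (range \<theta>)"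
  have m_le: "m \<le> \<theta> p" for p
    by (simp add: m_def)
  have m_in: "m \<in> range \<theta>"
    unfolding m_def by (rule Min_in) auto
  show ?case
  proof (cases "range \<theta> = {m}")
    case True
    then have "\<theta> = (\<lambda>_. m)" by auto
    then show ?thesis
      using total by (simp flip: sum_distrib_left)
  next
    case False
    define m' where "m' = Min (range \<theta> - {m})"
    have m'_in: "m' \<in> range \<theta> - {m}"
      unfolding m'_def using False m_in by (intro Min_in) auto
    have m'_le: "m' \<le> \<theta> p" if "\<theta> p \<noteq> m" for p
      unfolding m'_def using that by (intro Min_le) auto
    have "m < m'"
      using m'_in m_le by (auto simp: less_le)
    define \<theta>' where "\<theta>' p = max (\<theta> p) m'" for p
    define L where "L = {p. \<theta> p = m}"
    have "lower_set L"
      unfolding lower_set_def L_def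
      by (metis (mono_tags) antisym m_le mem_Collect_eq monoD[OF less.prems])
    then have wL: "(\<Sum>l\<in>L. w l) \<le> 0"
      by (rule lower)
    have "range \<theta>' \<subseteq> range \<theta> - {m}"
      using m'_in \<open>m < m'\<close> by (auto simp: \<theta>'_def max_def)
    then have "range \<theta>' \<subset> range \<theta>"
      using m_in by blast
    then have "card (range \<theta>') < card (range \<theta>)"
      by (simp add: psubset_card_mono)
    moreover have "mono \<theta>'"
      unfolding mono_def \<theta>'_def by (intro allI impI max.mono monoD[OF less.prems]) auto
    ultimately have IH: "0 \<le> (\<Sum>p\<in>UNIV. \<theta>' p * w p)"
      by (rule less.hyps)
    have "\<theta> p * w p = \<theta>' p * w p - (m' - m) * (if p \<in> L then w p else 0)" for p
      using m'_le[of p] \<open>m < m'\<close> by (auto simp: \<theta>'_def L_def max_def algebra_simps)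
    then have "(\<Sum>p\<in>UNIV. \<theta> p * w p) =
        (\<Sum>p\<in>UNIV. \<theta>' p * w p) - (m' - m) * (\<Sum>p\<in>UNIV. if p \<in> L then w p else 0)"
      by (simp only: sum_subtractf sum_distrib_left)
    also have "(\<Sum>p\<in>UNIV. if p \<in> L then w p else 0) = (\<Sum>l\<in>L. w l)"
      by (simp add: sum.If_cases)
    finally show ?thesis
      using IH wL \<open>m < m'\<close> mult_nonneg_nonpos[of "m' - m" "\<Sum>l\<in>L. w l"] by simp
  qed
qed


section \<open>Advantageous trades as sums of elementary trades\<close>

abbreviation elementary_trade :: "'p::finite \<Rightarrow> 'p \<Rightarrow> real ^ 'p"
  where "elementary_trade x y \<equiv> axis y 1 - axis x 1"

lemma sum_elementary_trade:
  "(\<Sum>l\<in>L. elementary_trade x y $ l) = (if y \<in> L then 1 else 0) - (if x \<in> L then 1 else 0)"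
  by (simp add: axis_def sum_subtractf)

lemma sum_trade_combination:
  "(\<Sum>l\<in>L. (\<Sum>k<n. c k *\<^sub>R elementary_trade (x k) (y k)) $ l) =
    (\<Sum>k<n. c k * ((if y k \<in> L then 1 else 0) - (if x k \<in> L then 1 else 0)))"
  unfolding sum_component vector_scaleR_component
  by (subst sum.swap) (simp only: sum_elementary_trade real_scaleR_def flip: sum_distrib_left)

theorem proposition3p9:
  fixes v :: "real ^ 'p::{finite,order}"
  shows "advantageous TYPE('k::field) v \<longleftrightarrow>
    (\<exists>(n::nat) (c :: nat \<Rightarrow> real) (x :: nat \<Rightarrow> 'p) (y :: nat \<Rightarrow> 'p).
      (\<forall>k<n. 0 \<le> c k \<and> x k < y k) \<and>
      v = (\<Sum>k<n. c k *\<^sub>R (axis (y k) 1 - axis (x k) 1)))"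
  unfolding advantageous_iff_lower_sums
proof
  assume R: "trade v \<and> (\<forall>L. lower_set L \<longrightarrow> (\<Sum>l\<in>L. v $ l) \<le> 0)"
  define I where "I = {(x :: 'p, y). x < y}"
  have "finite I" by simp
  have "v \<in> convex_cone hull ((\<lambda>(x, y). elementary_trade x y) ` I)"
  proof (rule in_convex_cone_hull_finite_if_dual_nonneg)
    fix a :: "(real, 'p) vec"
    assume a: "\<And>s. s \<in> (\<lambda>(x, y). elementary_trade x y) ` I \<Longrightarrow> 0 \<le> a \<bullet> s"
    have "a $ x \<le> a $ y" if "x < y" for x y
      using a[of "elementary_trade x y"] that
      by (force simp: I_def inner_diff_right inner_axis)
    then have "mono (($) a)"
      by (auto simp: mono_def le_less)
    then have "0 \<le> (\<Sum>p\<in>UNIV. a $ p * v $ p)"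
      using R by (intro monotone_pairing_nonneg) (auto simp: trade_def)
    then show "0 \<le> a \<bullet> v"
      by (simp add: inner_vec_def)
  qed simp
  then obtain c where c: "\<And>i. i \<in> I \<Longrightarrow> 0 \<le> c i"
    and v: "v = (\<Sum>i\<in>I. c i *\<^sub>R (case i of (x, y) \<Rightarrow> elementary_trade x y))"
    using convex_cone_hull_image_finite[OF \<open>finite I\<close>] by blast
  obtain h where h: "bij_betw h {..<card I} I"
    using ex_bij_betw_nat_finite[OF \<open>finite I\<close>] by (auto simp: lessThan_atLeast0)
  have hI: "h k \<in> I" if "k < card I" for k
    using bij_betwE[OF h] that by blast
  have "v = (\<Sum>k<card I. c (h k) *\<^sub>R elementary_trade (fst (h k)) (snd (h k)))"
    unfolding v by (subst sum.reindex_bij_betw[OF h, symmetric]) (simp add: case_prod_beta)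
  moreover have "\<forall>k<card I. 0 \<le> c (h k) \<and> fst (h k) < snd (h k)"
    using c hI by (force simp: I_def)
  ultimately show "\<exists>(n::nat) (c :: nat \<Rightarrow> real) (x :: nat \<Rightarrow> 'p) (y :: nat \<Rightarrow> 'p).
      (\<forall>k<n. 0 \<le> c k \<and> x k < y k) \<and> v = (\<Sum>k<n. c k *\<^sub>R elementary_trade (x k) (y k))"
    by - (rule exI[of _ "card I"], rule exI[of _ "\<lambda>k. c (h k)"],
        rule exI[of _ "\<lambda>k. fst (h k)"], rule exI[of _ "\<lambda>k. snd (h k)"], rule conjI)
next
  assume "\<exists>(n::nat) (c :: nat \<Rightarrow> real) (x :: nat \<Rightarrow> 'p) (y :: nat \<Rightarrow> 'p).
      (\<forall>k<n. 0 \<le> c k \<and> x k < y k) \<and> v = (\<Sum>k<n. c k *\<^sub>R elementary_trade (x k) (y k))"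
  then obtain n :: nat and c :: "nat \<Rightarrow> real" and x y :: "nat \<Rightarrow> 'p"
    where cxy: "\<And>k. k < n \<Longrightarrow> 0 \<le> c k \<and> x k < y k"
      and v: "v = (\<Sum>k<n. c k *\<^sub>R elementary_trade (x k) (y k))"
    by blast
  have "(\<Sum>l\<in>L. v $ l) \<le> 0" if L: "lower_set L" for L
    unfolding v sum_trade_combination
  proof (rule sum_nonpos)
    fix k assume "k \<in> {..<n}"
    then have "0 \<le> c k" "x k < y k"
      using cxy by auto
    then have "y k \<in> L \<longrightarrow> x k \<in> L"
      using L unfolding lower_set_def by (meson less_imp_le)
    then show "c k * ((if y k \<in> L then 1 else 0) - (if x k \<in> L then 1 else 0)) \<le> 0"
      using \<open>0 \<le> c k\<close> by auto
  qed
  moreover have "trade v"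
    unfolding trade_def v sum_trade_combination by simp
  ultimately show "trade v \<and> (\<forall>L. lower_set L \<longrightarrow> (\<Sum>l\<in>L. v $ l) \<le> 0)"
    by blast
qed

end
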